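(* Let $a,b,c\in\mathbb{R}$ with $a>0$, $c>0$, $b^{2}-4ac<0$ and $b\neq 0$, let $\Omega=\{(x_1,x_2)\in\mathbb{R}^2 : ax_{1}^{2}+bx_{1}x_{2}+cx_{2}^{2}<1\}$, and let $T>0$. Then the function, constant in $x\in\Omega$, $$w(t)=\frac{1}{T-t}\cdot\frac{2a+2c}{b},\qquad 0\le t<T,$$ is a self-similar singular solution (becoming singular at time $T$) of the equation $$w_{t}=(Z_{12}w)\,w,\qquad x\in\Omega.$$
   Context: For a bounded domain $\Omega\subset\mathbb{R}^2$ and a function $f$ on $\Omega$, $\Delta^{-1}f$ denotes the solution $\psi$ of the Dirichlet problem $\Delta\psi=f$ in $\Omega$, $\psi|_{\partial\Omega}=0$ (homogeneous Dirichlet boundary condition). The operator $Z_{ij}$ is defined by $Z_{ij}f=\partial_{x_i}\partial_{x_j}\Delta^{-1}f$ on $\Omega$, so $Z_{12}=\partial_{x_1}\partial_{x_2}\Delta^{-1}$; it acts in the space variable $x$ only. The product $(Z_{12}w)\,w$ is the pointwise product. A self-similar singular solution is a solution on $0\le t<T$ of the form $w(x,t)=\frac{1}{T-t}Q\!\left(\frac{x}{T-t}\right)$ with a profile $Q$ not identically zero, so that $w$ blows up as $t\to T^-$; in the present case $Q$ is a nonzero constant. *)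

theory Defs
  imports "HOL-Analysis.Analysis"
begin

definition partial_deriv :: "'n::finite \<Rightarrow> (real^'n \<Rightarrow> real) \<Rightarrow> real^'n \<Rightarrow> real" where
  "partial_deriv i f x = frechet_derivative f (at x) (axis i 1)"

definition C2_on :: "(real^'n::finite) set \<Rightarrow> (real^'n \<Rightarrow> real) \<Rightarrow> bool" where
  "C2_on S f \<longleftrightarrow>
     (\<forall>x\<in>S. f differentiable at x) \<and>
     (\<forall>i. \<forall>x\<in>S. partial_deriv i f differentiable at x) \<and>
     (\<forall>i j. continuous_on S (partial_deriv i (partial_deriv j f)))"

definition laplacian :: "(real^'n::finite \<Rightarrow> real) \<Rightarrow> real^'n \<Rightarrow> real" where
  "laplacian f x = (\<Sum>i\<in>UNIV. partial_deriv i (partial_deriv i f) x)"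

text \<open>Classical solutions of the Dirichlet problem. A function on the closure of \<open>\<Omega>\<close> is
  represented by a total function vanishing off the closure, so that a solution that is
  unique on the closure is unique as a HOL function.\<close>

definition dirichlet_solution ::
    "(real^'n::finite) set \<Rightarrow> (real^'n \<Rightarrow> real) \<Rightarrow> (real^'n \<Rightarrow> real) \<Rightarrow> bool" where
  "dirichlet_solution \<Omega> f \<psi> \<longleftrightarrow>
     C2_on \<Omega> \<psi> \<and> continuous_on (closure \<Omega>) \<psi> \<and>
     (\<forall>x\<in>\<Omega>. laplacian \<psi> x = f x) \<and>
     (\<forall>x\<in>frontier \<Omega>. \<psi> x = 0) \<and>
     (\<forall>x. x \<notin> closure \<Omega> \<longrightarrow> \<psi> x = 0)"

definition inv_laplacian ::
    "(real^'n::finite) set \<Rightarrow> (real^'n \<Rightarrow> real) \<Rightarrow> real^'n \<Rightarrow> real" where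
  "inv_laplacian \<Omega> f = (THE \<psi>. dirichlet_solution \<Omega> f \<psi>)"

definition Z_op ::
    "(real^'n::finite) set \<Rightarrow> 'n \<Rightarrow> 'n \<Rightarrow> (real^'n \<Rightarrow> real) \<Rightarrow> real^'n \<Rightarrow> real" where
  "Z_op \<Omega> i j f = partial_deriv i (partial_deriv j (inv_laplacian \<Omega> f))"

text \<open>Solutions of \<open>w\<^sub>t = (Z\<^sub>1\<^sub>2 w) w\<close> on \<open>0 \<le> t < T\<close>, with a one-sided time derivative at \<open>t = 0\<close>.
  Unique solvability of the Dirichlet problem is demanded at each time because \<open>inv_laplacian\<close>
  has no meaning without it.\<close>

definition Z12_solution ::
    "(real^2) set \<Rightarrow> real \<Rightarrow> (real \<Rightarrow> real^2 \<Rightarrow> real) \<Rightarrow> bool" where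
  "Z12_solution \<Omega> T w \<longleftrightarrow>
     (\<forall>t\<in>{0..<T}.
        (\<exists>!\<psi>. dirichlet_solution \<Omega> (w t) \<psi>) \<and>
        (\<forall>x\<in>\<Omega>. ((\<lambda>s. w s x) has_real_derivative Z_op \<Omega> 1 2 (w t) x * w t x)
                   (at t within {0..<T})))"

text \<open>The profile is required to be nonzero at a point it is actually evaluated at; the last
  conjunct says that the supremum over \<open>\<Omega>\<close> of \<open>\<bar>w t x\<bar>\<close> tends to infinity as \<open>t\<close> increases to \<open>T\<close>.\<close>

definition self_similar_singular_solution ::
    "(real^2) set \<Rightarrow> real \<Rightarrow> (real^2 \<Rightarrow> real) \<Rightarrow> (real \<Rightarrow> real^2 \<Rightarrow> real) \<Rightarrow> bool" where
  "self_similar_singular_solution \<Omega> T Q w \<longleftrightarrow>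
     Z12_solution \<Omega> T w \<and>
     (\<forall>t\<in>{0..<T}. \<forall>x\<in>\<Omega>. w t x = 1 / (T - t) * Q ((1 / (T - t)) *\<^sub>R x)) \<and>
     (\<exists>t\<in>{0..<T}. \<exists>x\<in>\<Omega>. Q ((1 / (T - t)) *\<^sub>R x) \<noteq> 0) \<and>
     (\<forall>M. \<forall>\<^sub>F t in at_left T. \<exists>x\<in>\<Omega>. M < \<bar>w t x\<bar>)"

end

theory Submission
  imports Defs
begin

text \<open>The function \<open>(a x\<^sub>1\<^sup>2 + b x\<^sub>1 x\<^sub>2 + c x\<^sub>2\<^sup>2 - 1) / (2a + 2c)\<close> vanishes on the boundary ellipse and has
  Laplacian \<open>1\<close>, so \<open>Z\<^sub>1\<^sub>2\<close> multiplies spatial constants by \<open>b / (2a + 2c)\<close> and the equation reduces to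
  the ODE \<open>w' = b / (2a + 2c) w\<^sup>2\<close>. That this function is the only solution of the Dirichlet problem
  follows from the weak maximum principle.\<close>

section \<open>Partial derivatives along coordinate lines and the second derivative test\<close>

lemma partial_derivI:
  assumes "(f has_derivative f') (at x)"
  shows "partial_deriv i f x = f' (axis i 1)"
  using frechet_derivative_at[OF assms] by (simp add: partial_deriv_def)

text \<open>Chain rule on a coordinate line: it turns partial derivatives into ordinary ones, so
  that one-variable calculus applies at a maximum.\<close>

lemma has_real_derivative_along_axis:
  assumes "f differentiable at (p + s *\<^sub>R axis i 1)"
  shows "((\<lambda>s. f (p + s *\<^sub>R axis i 1)) has_real_derivative
           partial_deriv i f (p + s *\<^sub>R axis i 1)) (at s)"
proof -
  let ?x = "p + s *\<^sub>R axis i 1"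
  let ?f' = "frechet_derivative f (at ?x)"
  have f': "(f has_derivative ?f') (at ?x)"
    using assms by (simp add: frechet_derivative_works)
  have "((\<lambda>s. p + s *\<^sub>R axis i 1) has_derivative (\<lambda>h. h *\<^sub>R axis i 1)) (at s)"
    by (auto intro!: derivative_eq_intros)
  then have "((\<lambda>s. f (p + s *\<^sub>R axis i 1)) has_derivative (\<lambda>h. ?f' (h *\<^sub>R axis i 1))) (at s)"
    using has_derivative_compose f' by fastforce
  moreover have "?f' (h *\<^sub>R axis i 1) = partial_deriv i f ?x * h" for h
    using linear_scale[OF has_derivative_linear[OF f']] by (simp add: partial_deriv_def)
  ultimately show ?thesis
    by (simp add: has_field_derivative_def)
qed

text \<open>If \<open>D\<close> were positive, \<open>g'\<close> would be positive just to the right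
  of its zero at 0, and the mean value theorem would push \<open>g\<close> above its maximum. The
  second derivative is needed at 0 only.\<close>

lemma second_derivative_nonpos_at_max:
  fixes g g' :: "real \<Rightarrow> real"
  assumes "d > 0"
    and deriv: "\<And>s. \<bar>s\<bar> < d \<Longrightarrow> (g has_real_derivative g' s) (at s)"
    and deriv2: "(g' has_real_derivative D) (at 0)"
    and max: "\<And>s. \<bar>s\<bar> < d \<Longrightarrow> g s \<le> g 0"
  shows "D \<le> 0"
proof (rule ccontr)
  assume "\<not> D \<le> 0"
  have g'0: "g' 0 = 0"
    using DERIV_local_max[OF deriv[of 0] \<open>d > 0\<close>] max \<open>d > 0\<close> by simp
  obtain e where e: "e > 0" "\<And>h. 0 < h \<Longrightarrow> h < e \<Longrightarrow> g' 0 < g' (0 + h)"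
    using DERIV_pos_inc_right[OF deriv2] \<open>\<not> D \<le> 0\<close> by force
  \<comment> \<open>Halving puts \<open>m\<close> strictly inside both the range where
    \<open>g\<close> is differentiable and the range where \<open>g'\<close> is positive.\<close>
  define m where "m = min d e / 2"
  have m: "0 < m" "m < d" "m < e"
    using \<open>d > 0\<close> \<open>e > 0\<close> by (auto simp: m_def)
  have "\<exists>z. 0 < z \<and> z < m \<and> g m - g 0 = (m - 0) * g' z"
    using m by (intro MVT2 deriv) auto
  then obtain z where "0 < z" "z < m" "g m - g 0 = m * g' z"
    by auto
  moreover have "g' z > 0"
    using e(2)[of z] \<open>0 < z\<close> \<open>z < m\<close> m g'0 by simp
  ultimately have "g m > g 0"
    using m by (simp add: algebra_simps)
  with max[of m] m show False
    by simp
qed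

section \<open>Weak maximum principle and uniqueness for the Dirichlet problem\<close>

text \<open>If \<open>u - v\<close> is positive somewhere, a slightly convexified difference has an
  interior maximum. There all its pure second derivatives are nonpositive, although its Laplacian is
  positive. Exchanging \<open>u\<close> and \<open>v\<close> yields uniqueness.\<close>

lemma dirichlet_solution_le:
  fixes \<Omega> :: "(real^'n::finite) set"
  assumes "open \<Omega>" "bounded \<Omega>"
    and u: "dirichlet_solution \<Omega> f u" and v: "dirichlet_solution \<Omega> f v"
  shows "u x \<le> v x"
proof (rule ccontr)
  assume "\<not> u x \<le> v x"
  \<comment> \<open>Off the closure both solutions vanish, so they cannot differ there.\<close>
  have x: "x \<in> closure \<Omega>"
    using u v \<open>\<not> u x \<le> v x\<close> unfolding dirichlet_solution_def by (metis order_refl)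
  obtain B where B: "\<And>y. y \<in> closure \<Omega> \<Longrightarrow> y \<bullet> y \<le> B"
  proof -
    obtain b where "\<And>y. y \<in> closure \<Omega> \<Longrightarrow> norm y \<le> b"
      using \<open>bounded \<Omega>\<close> bounded_closure bounded_iff by metis
    then have "y \<bullet> y \<le> b\<^sup>2" if "y \<in> closure \<Omega>" for y
      using that by (simp add: dot_square_norm power_mono)
    then show thesis using that by blast
  qed
  \<comment> \<open>Chosen to give \<open>e * \<bar>B\<bar> < u x - v x\<close>; the absolute value
    and the added 1 make the denominator positive without a sign condition on
    \<open>B\<close>.\<close>
  define e where "e = (u x - v x) / (\<bar>B\<bar> + 1)"
  have "e > 0"
    using \<open>\<not> u x \<le> v x\<close> by (simp add: e_def)
  have eB: "e * \<bar>B\<bar> < u x - v x"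
    using \<open>\<not> u x \<le> v x\<close> mult_strict_left_mono[of "\<bar>B\<bar>" "\<bar>B\<bar> + 1" "u x - v x"]
    by (simp add: e_def pos_divide_less_eq)
  \<comment> \<open>The term \<open>e |y|\<^sup>2\<close> makes the Laplacian strictly positive, yet is too small to move the
    maximum to the boundary.\<close>
  define G where "G y = u y - v y + e * (y \<bullet> y)" for y
  have "compact (closure \<Omega>)"
    using \<open>bounded \<Omega>\<close> by (simp add: compact_closure)
  moreover have "continuous_on (closure \<Omega>) G"
    using u v unfolding G_def[abs_def] dirichlet_solution_def
    by (intro continuous_intros) auto
  ultimately obtain p where p: "p \<in> closure \<Omega>" "\<And>y. y \<in> closure \<Omega> \<Longrightarrow> G y \<le> G p"
    using continuous_attains_sup[of "closure \<Omega>" G] x by (metis empty_iff)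
  \<comment> \<open>On the frontier \<open>u\<close> and \<open>v\<close> vanish, so
    \<open>G\<close> is at most \<open>e * \<bar>B\<bar>\<close> there, less than its value at
    \<open>x\<close>.\<close>
  have "p \<notin> frontier \<Omega>"
  proof
    assume "p \<in> frontier \<Omega>"
    then have "G p = e * (p \<bullet> p)"
      using u v by (simp add: G_def dirichlet_solution_def)
    also have "\<dots> \<le> e * \<bar>B\<bar>"
      using B[OF p(1)] \<open>e > 0\<close> by (intro mult_left_mono) auto
    also have "\<dots> < G x"
      using eB \<open>e > 0\<close> mult_nonneg_nonneg[OF less_imp_le inner_ge_zero, of e x]
      unfolding G_def by linarith
    finally show False
      using p(2)[OF x] by simp
  qed
  then have "p \<in> \<Omega>"
    using p(1) \<open>open \<Omega>\<close> by (simp add: frontier_def interior_open)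
  then obtain d where d: "d > 0" "ball p d \<subseteq> \<Omega>"
    using \<open>open \<Omega>\<close> open_contains_ball by blast
  have "partial_deriv i (partial_deriv i u) p - partial_deriv i (partial_deriv i v) p + 2 * e \<le> 0"
    for i :: 'n
  proof (rule second_derivative_nonpos_at_max[OF \<open>d > 0\<close>])
    fix s :: real assume "\<bar>s\<bar> < d"
    then have s: "p + s *\<^sub>R axis i 1 \<in> \<Omega>"
      using d(2) by (force simp: dist_norm)
    then show "G (p + s *\<^sub>R axis i 1) \<le> G (p + 0 *\<^sub>R axis i 1)"
      using p(2) closure_subset by auto
    \<comment> \<open>Since \<open>axis i 1\<close> is a unit vector, the perturbation is quadratic
      in \<open>s\<close> with leading coefficient \<open>e\<close>; it contributes
      \<open>2 * e\<close> to the second derivative.\<close>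
    have G_axis: "(\<lambda>s. G (p + s *\<^sub>R axis i 1)) =
        (\<lambda>s. u (p + s *\<^sub>R axis i 1) - v (p + s *\<^sub>R axis i 1)
              + e * (p \<bullet> p + 2 * s * p $ i + s\<^sup>2))"
      by (simp add: G_def fun_eq_iff inner_add_left inner_add_right inner_axis inner_axis'
          power2_eq_square distrib_left)
    show "((\<lambda>s. G (p + s *\<^sub>R axis i 1)) has_real_derivative
        partial_deriv i u (p + s *\<^sub>R axis i 1) - partial_deriv i v (p + s *\<^sub>R axis i 1)
          + e * (2 * p $ i + 2 * s)) (at s)"
      unfolding G_axis using u v s
      by (auto simp: dirichlet_solution_def C2_on_def
          intro!: has_real_derivative_along_axis derivative_eq_intros)
  next
    have "((\<lambda>s. partial_deriv i w (p + s *\<^sub>R axis i 1)) has_real_derivative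
        partial_deriv i (partial_deriv i w) p) (at 0)" if "dirichlet_solution \<Omega> f w" for w
      using has_real_derivative_along_axis[of "partial_deriv i w" p 0 i] that \<open>p \<in> \<Omega>\<close>
      by (auto simp: dirichlet_solution_def C2_on_def)
    from this[OF u] this[OF v]
    show "((\<lambda>s. partial_deriv i u (p + s *\<^sub>R axis i 1) - partial_deriv i v (p + s *\<^sub>R axis i 1)
          + e * (2 * p $ i + 2 * s)) has_real_derivative
        partial_deriv i (partial_deriv i u) p - partial_deriv i (partial_deriv i v) p + 2 * e)
        (at 0)"
      by (auto intro!: derivative_eq_intros)
  qed
  \<comment> \<open>Summing over the axes produces the two Laplacians, which cancel because both
    equal \<open>f p\<close>; a positive multiple of \<open>e\<close> remains.\<close>
  then have "(\<Sum>i\<in>UNIV. partial_deriv i (partial_deriv i u) p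
      - partial_deriv i (partial_deriv i v) p + 2 * e) \<le> 0"
    by (intro sum_nonpos) auto
  then have "laplacian u p - laplacian v p + CARD('n) * (2 * e) \<le> 0"
    by (simp add: laplacian_def sum.distrib sum_subtractf)
  moreover have "laplacian u p = laplacian v p"
    using u v \<open>p \<in> \<Omega>\<close> by (simp add: dirichlet_solution_def)
  moreover have "real CARD('n) * (2 * e) > 0"
    using \<open>e > 0\<close> by simp
  ultimately show False
    by simp
qed

lemma dirichlet_solution_unique:
  fixes \<Omega> :: "(real^'n::finite) set"
  assumes "open \<Omega>" "bounded \<Omega>" "dirichlet_solution \<Omega> f u" "dirichlet_solution \<Omega> f v"
  shows "u = v"
  using dirichlet_solution_le assms by (metis antisym ext)

section \<open>Coordinate derivatives and the geometry of the ellipse\<close>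

lemma has_derivative_vec_nth:
  "((\<lambda>x. x $ i) has_derivative (\<lambda>h. h $ i)) (at (x :: real^'n::finite))"
  by (intro bounded_linear_imp_has_derivative bounded_linear_vec_nth)

context
  fixes a b c :: real and q :: "real^2 \<Rightarrow> real" and \<Omega> :: "(real^2) set"
  assumes pos: "a > 0" "c > 0" "b\<^sup>2 - 4 * a * c < 0"
  defines "q \<equiv> \<lambda>x. a * (x$1)\<^sup>2 + b * (x$1) * (x$2) + c * (x$2)\<^sup>2"
  defines "\<Omega> \<equiv> {x. q x < 1}"
begin

lemma continuous_on_form: "continuous_on S q"
  unfolding q_def by (intro continuous_intros)

lemma open_ellipse: "open \<Omega>"
  unfolding \<Omega>_def using open_Collect_less[OF continuous_on_form continuous_on_const] .

text \<open>Continuity gives \<open>q x \<le> 1\<close> on the closure, and openness keeps frontier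
  points out of \<open>\<Omega>\<close>. This one inclusion is all that the boundary condition
  requires.\<close>

lemma frontier_ellipse: "x \<in> frontier \<Omega> \<Longrightarrow> q x = 1"
proof -
  assume "x \<in> frontier \<Omega>"
  then have "x \<in> closure \<Omega>" "x \<notin> \<Omega>"
    using open_ellipse by (auto simp: frontier_def interior_open)
  have "closed {x. q x \<le> 1}"
    using closed_Collect_le[OF continuous_on_form continuous_on_const] .
  then have "closure \<Omega> \<subseteq> {x. q x \<le> 1}"
    by (intro closure_minimal) (auto simp: \<Omega>_def)
  with \<open>x \<in> closure \<Omega>\<close> \<open>x \<notin> \<Omega>\<close> show ?thesis
    by (auto simp: \<Omega>_def)
qed

text \<open>Completing the square in one variable bounds the other, because the negated discriminant
  \<open>D\<close> is positive.\<close>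

lemma bounded_ellipse: "bounded \<Omega>"
proof -
  define D where "D = 4 * a * c - b\<^sup>2"
  have "D > 0"
    using pos by (simp add: D_def)
  have bound: "y\<^sup>2 \<le> k / D" if "D * y\<^sup>2 \<le> k * r" "r < 1" "k > 0" for y k r :: real
  proof -
    have "k * r \<le> k"
      using that by (simp add: mult_left_le)
    then show ?thesis
      using that(1) \<open>D > 0\<close> by (simp add: field_simps)
  qed
  have "norm x \<le> sqrt (4 * c / D) + sqrt (4 * a / D)" if "x \<in> \<Omega>" for x
  proof -
    \<comment> \<open>Dropping the first square leaves
      \<open>D * (x$2)\<^sup>2 \<le> 4 * a * q x\<close>, the form that \<open>bound\<close>
      expects; the second identity exchanges the roles of the coordinates.\<close>
    have "4 * a * q x = (2 * a * x$1 + b * x$2)\<^sup>2 + D * (x$2)\<^sup>2"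
      by (simp add: q_def D_def power2_eq_square algebra_simps)
    then have "(x$2)\<^sup>2 \<le> 4 * a / D"
      using bound[of "x$2" "4 * a" "q x"] that pos by (simp add: \<Omega>_def)
    moreover have "4 * c * q x = (2 * c * x$2 + b * x$1)\<^sup>2 + D * (x$1)\<^sup>2"
      by (simp add: q_def D_def power2_eq_square algebra_simps)
    then have "(x$1)\<^sup>2 \<le> 4 * c / D"
      using bound[of "x$1" "4 * c" "q x"] that pos by (simp add: \<Omega>_def)
    ultimately have "\<bar>x$1\<bar> \<le> sqrt (4 * c / D)" "\<bar>x$2\<bar> \<le> sqrt (4 * a / D)"
      using real_sqrt_le_mono real_sqrt_abs by metis+
    then show ?thesis
      using norm_le_l1_cart[of x] by (simp add: sum_2)
  qed
  then show ?thesis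
    unfolding bounded_iff by blast
qed

section \<open>The explicit potential of a constant and its derivatives\<close>

text \<open>The factor normalises the Laplacian, as that of \<open>q\<close> is
  \<open>2 * a + 2 * c\<close>. The value 0 off the closure is the convention built into
  \<open>dirichlet_solution\<close>.\<close>

definition ellipse_potential :: "real \<Rightarrow> real^2 \<Rightarrow> real" where
  "ellipse_potential k x = (if x \<in> closure \<Omega> then k / (2 * a + 2 * c) * (q x - 1) else 0)"

lemma form_has_derivative:
  "((\<lambda>x. K * (q x - 1)) has_derivative
    (\<lambda>h. K * (2 * a * x$1 + b * x$2) * h$1 + K * (b * x$1 + 2 * c * x$2) * h$2)) (at x)"
  unfolding q_def
  by (rule derivative_eq_intros has_derivative_vec_nth refl)+
    (simp add: fun_eq_iff algebra_simps)

text \<open>Around a point of the open set \<open>\<Omega>\<close> the cut-off is invisible, so the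
  quadratic polynomial determines the derivative.\<close>

lemma ellipse_potential_has_derivative:
  assumes "x \<in> \<Omega>"
  shows "(ellipse_potential k has_derivative
    (\<lambda>h. k / (2 * a + 2 * c) * (2 * a * x$1 + b * x$2) * h$1
         + k / (2 * a + 2 * c) * (b * x$1 + 2 * c * x$2) * h$2)) (at x)"
proof (rule has_derivative_transform_within_open[OF form_has_derivative open_ellipse assms])
  show "k / (2 * a + 2 * c) * (q y - 1) = ellipse_potential k y" if "y \<in> \<Omega>" for y
    using that closure_subset by (auto simp: ellipse_potential_def)
qed

lemma partial_deriv_ellipse_potential:
  assumes "x \<in> \<Omega>"
  shows "partial_deriv i (ellipse_potential k) x = k / (2 * a + 2 * c) *
    (if i = 1 then 2 * a * x$1 + b * x$2 else b * x$1 + 2 * c * x$2)"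
  using partial_derivI[OF ellipse_potential_has_derivative[OF assms]] exhaust_2[of i]
  by (auto simp: axis_def)

text \<open>The formula for the first partials holds on \<open>\<Omega>\<close>, which is open, so
  it may be differentiated again; being linear in the point, it is its own derivative.\<close>

lemma partial_deriv_ellipse_potential_has_derivative:
  assumes "x \<in> \<Omega>"
  shows "(partial_deriv i (ellipse_potential k) has_derivative
    (\<lambda>h. k / (2 * a + 2 * c) *
      (if i = 1 then 2 * a * h$1 + b * h$2 else b * h$1 + 2 * c * h$2))) (at x)"
    (is "(_ has_derivative ?L) _")
proof (rule has_derivative_transform_within_open[OF _ open_ellipse assms])
  show "(?L has_derivative ?L) (at x)"
    by (cases "i = 1"; simp only: simp_thms if_True if_False;
        intro has_derivative_mult_right has_derivative_add has_derivative_vec_nth)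
  show "?L y = partial_deriv i (ellipse_potential k) y" if "y \<in> \<Omega>" for y
    using partial_deriv_ellipse_potential[OF that] by simp
qed

lemma partial_deriv2_ellipse_potential:
  assumes "x \<in> \<Omega>"
  shows "partial_deriv j (partial_deriv i (ellipse_potential k)) x =
    k / (2 * a + 2 * c) * (if i = j then if i = 1 then 2 * a else 2 * c else b)"
  using partial_derivI[OF partial_deriv_ellipse_potential_has_derivative[OF assms]]
    exhaust_2[of i] exhaust_2[of j]
  by (auto simp: axis_def)

lemma dirichlet_solution_ellipse_potential:
  "dirichlet_solution \<Omega> (\<lambda>x. k) (ellipse_potential k)"
proof -
  have "C2_on \<Omega> (ellipse_potential k)"
    unfolding C2_on_def
    using differentiableI[OF ellipse_potential_has_derivative]
      differentiableI[OF partial_deriv_ellipse_potential_has_derivative]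
    by (simp add: partial_deriv2_ellipse_potential cong: continuous_on_cong)
  moreover have "continuous_on (closure \<Omega>) (\<lambda>x. k / (2 * a + 2 * c) * (q x - 1))"
    by (intro continuous_intros continuous_on_form)
  then have "continuous_on (closure \<Omega>) (ellipse_potential k)"
    by (rule continuous_on_eq) (simp add: ellipse_potential_def)
  moreover have "laplacian (ellipse_potential k) x = k" if "x \<in> \<Omega>" for x
  proof -
    have "laplacian (ellipse_potential k) x = k / (2 * a + 2 * c) * (2 * a + 2 * c)"
      using that unfolding distrib_left
      by (simp add: laplacian_def sum_2 partial_deriv2_ellipse_potential)
    then show ?thesis
      using pos by simp
  qed
  moreover have "ellipse_potential k x = 0" if "x \<in> frontier \<Omega>" for x
    using frontier_ellipse[OF that] by (simp add: ellipse_potential_def)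
  ultimately show ?thesis
    by (simp add: dirichlet_solution_def ellipse_potential_def)
qed

lemma ex1_dirichlet_solution_ellipse: "\<exists>!\<psi>. dirichlet_solution \<Omega> (\<lambda>x. k) \<psi>"
  using dirichlet_solution_ellipse_potential
    dirichlet_solution_unique[OF open_ellipse bounded_ellipse] by blast

text \<open>Uniqueness identifies the definite description in \<open>inv_laplacian\<close> with the
  explicit potential, whose mixed second derivative is constant on \<open>\<Omega>\<close>.\<close>

lemma Z_op_ellipse_const:
  assumes "x \<in> \<Omega>"
  shows "Z_op \<Omega> 1 2 (\<lambda>x. k) x = k * b / (2 * a + 2 * c)"
proof -
  have "inv_laplacian \<Omega> (\<lambda>x. k) = ellipse_potential k"
    unfolding inv_laplacian_def
    using dirichlet_solution_ellipse_potential ex1_dirichlet_solution_ellipse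
    by (rule the1_equality[rotated])
  then show ?thesis
    using partial_deriv2_ellipse_potential[OF assms] by (simp add: Z_op_def)
qed

end

section \<open>The scalar equation for spatial constants and its blow-up\<close>

theorem theorem2p2:
  fixes a b c T :: real and \<Omega> :: "(real^2) set"
  assumes "a > 0" and "c > 0" and "b\<^sup>2 - 4 * a * c < 0" and "b \<noteq> 0"
    and "\<Omega> = {x. a * (x$1)\<^sup>2 + b * (x$1) * (x$2) + c * (x$2)\<^sup>2 < 1}"
    and "T > 0"
  shows "self_similar_singular_solution \<Omega> T
           (\<lambda>y. (2 * a + 2 * c) / b)
           (\<lambda>t x. 1 / (T - t) * ((2 * a + 2 * c) / b))"
proof -
  \<comment> \<open>\<open>A\<close> is the constant profile and also the reciprocal of the factor
    by which \<open>Z_op\<close> multiplies constants.\<close>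
  define A where "A = (2 * a + 2 * c) / b"
  have "A \<noteq> 0"
    using assms by (simp add: A_def add_pos_pos pos_add_strict order_less_imp_not_eq2)
  \<comment> \<open>The origin serves as the witness both for the nonzero profile and for the
    blow-up.\<close>
  have "0 \<in> \<Omega>"
    using assms(5) by simp
  have Z: "Z_op \<Omega> 1 2 (\<lambda>x. k) x = k / A" if "x \<in> \<Omega>" for k x
    using Z_op_ellipse_const[OF assms(1-3)] that unfolding assms(5) A_def by simp
  have "Z12_solution \<Omega> T (\<lambda>t x. 1 / (T - t) * A)"
    unfolding Z12_solution_def
  proof (intro ballI conjI)
    fix t assume t: "t \<in> {0..<T}"
    show "\<exists>!\<psi>. dirichlet_solution \<Omega> (\<lambda>x. 1 / (T - t) * A) \<psi>"
      using ex1_dirichlet_solution_ellipse[OF assms(1-3)] unfolding assms(5) .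
    fix x assume "x \<in> \<Omega>"
    have "((\<lambda>s. 1 / (T - s) * A) has_real_derivative A / (T - t)\<^sup>2) (at t within {0..<T})"
      using t by (auto intro!: derivative_eq_intros simp: power2_eq_square)
    \<comment> \<open>For \<open>k = A / (T - t)\<close> the right-hand side is
      \<open>(k / A) * k\<close>, which is \<open>A / (T - t)\<^sup>2\<close>.\<close>
    then show "((\<lambda>s. 1 / (T - s) * A) has_real_derivative
        Z_op \<Omega> 1 2 (\<lambda>x. 1 / (T - t) * A) x * (1 / (T - t) * A)) (at t within {0..<T})"
      using \<open>A \<noteq> 0\<close> by (simp add: Z[OF \<open>x \<in> \<Omega>\<close>] power2_eq_square)
  qed
  moreover have "\<forall>\<^sub>F t in at_left T. \<exists>x\<in>\<Omega>. M < \<bar>1 / (T - t) * A\<bar>" for M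
  proof -
    \<comment> \<open>Within distance \<open>d\<close> to the left of \<open>T\<close>,
      \<open>\<bar>A\<bar> / (T - t)\<close> exceeds \<open>\<bar>M\<bar> + 1\<close>, hence
      \<open>M\<close> whatever its sign.\<close>
    define d where "d = \<bar>A\<bar> / (\<bar>M\<bar> + 1)"
    have "d > 0"
      using \<open>A \<noteq> 0\<close> by (simp add: d_def)
    then have "\<forall>\<^sub>F t in at_left T. t \<in> {T - d<..<T}"
      by (intro eventually_at_left_real) simp
    then show ?thesis
    proof (rule eventually_mono)
      fix t assume t: "t \<in> {T - d<..<T}"
      then have "(T - t) * (\<bar>M\<bar> + 1) < \<bar>A\<bar>"
        by (simp add: d_def field_simps)
      then have "\<bar>M\<bar> + 1 < \<bar>A\<bar> / (T - t)"
        using t by (simp add: field_simps)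
      then show "\<exists>x\<in>\<Omega>. M < \<bar>1 / (T - t) * A\<bar>"
        using t \<open>0 \<in> \<Omega>\<close> by (auto simp: abs_mult)
    qed
  qed
  \<comment> \<open>Positivity of \<open>T\<close> makes \<open>{0..<T}\<close> nonempty, which
    supplies a time at which the profile is evaluated.\<close>
  ultimately show ?thesis
    using \<open>A \<noteq> 0\<close> \<open>0 \<in> \<Omega>\<close> \<open>T > 0\<close>
    unfolding self_similar_singular_solution_def A_def[symmetric] by force
qed

end
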